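(* Let $G$ be a finite simple graph of order $n$ with $m$ edges and minimum degree $\delta$, and let $k\geq 0$ and $t\geq 1$ be integers. Then $$\mathrm{sp}(G,k)\ \geq\ \frac{2\left( n\left(\delta+t(k+1)\right)-2m+\sum_{v\in V(G)}\varepsilon_{t}(\deg(v))\right)}{(k+1)\,t(t+1)} .$$
   Context: For a graph $G$ and $B\subseteq V(G)$ the spread is $\mathrm{sp}(B)=\max_{u\in B}\deg_G(u)-\min_{v\in B}\deg_G(v)$, and $\mathrm{sp}(G,k)$ is the largest cardinality of a set $B\subseteq V(G)$ with $\mathrm{sp}(B)\leq k$. Put $h=k+1$. For $i\geq 0$ let $I_i=\{\delta+ih,\delta+ih+1,\ldots,\delta+ih+k\}$, and let $\mu(x,i)=1$ if $x\in I_i$ and $\mu(x,i)=0$ otherwise. For integers $t\geq 1$ and $x\geq\delta$ put $$u_t(x)=\sum_{i=0}^{t-1}(t-i)\,\mu(x,i),\qquad \varepsilon_t(x)=h\,u_t(x)-(\delta+th-x).$$ *)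

theory Defs
  imports Complex_Main
begin

(* Edges are unordered pairs, so that "card E" is the number of edges of the graph. *)
locale finite_simple_graph =
  fixes V :: "'a set" and E :: "'a set set"
  assumes finite_vertices: "finite V"
    and edge_subset: "e \<in> E \<Longrightarrow> e \<subseteq> V"
    and edge_card: "e \<in> E \<Longrightarrow> card e = 2"

definition degree :: "'a set set \<Rightarrow> 'a \<Rightarrow> nat" where
  "degree E v = card {e \<in> E. v \<in> e}"

definition min_degree :: "'a set \<Rightarrow> 'a set set \<Rightarrow> nat" where
  "min_degree V E = Min (degree E ` V)"

(* Only meaningful for finite nonempty B. *)
definition spread :: "'a set set \<Rightarrow> 'a set \<Rightarrow> int" where
  "spread E B = int (Max (degree E ` B)) - int (Min (degree E ` B))"

(* The maximum and minimum in the spread require B to be nonempty. For a nonempty finite vertex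
   set, the set below is finite, and it is nonempty because singletons have spread 0. *)
definition sp :: "'a set \<Rightarrow> 'a set set \<Rightarrow> nat \<Rightarrow> nat" where
  "sp V E k = Max {card B | B. B \<subseteq> V \<and> B \<noteq> {} \<and> spread E B \<le> int k}"

(* In what follows d stands for the minimum degree, and k + 1 for h. *)
definition deg_interval :: "nat \<Rightarrow> nat \<Rightarrow> nat \<Rightarrow> nat set" where
  "deg_interval d k i = {d + i * (k + 1) .. d + i * (k + 1) + k}"

definition mu :: "nat \<Rightarrow> nat \<Rightarrow> nat \<Rightarrow> nat \<Rightarrow> int" where
  "mu d k x i = (if x \<in> deg_interval d k i then 1 else 0)"

definition u_sum :: "nat \<Rightarrow> nat \<Rightarrow> nat \<Rightarrow> nat \<Rightarrow> int" where
  "u_sum d k t x = (\<Sum>i = 0..<t. (int t - int i) * mu d k x i)"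

(* Intended for x at least d and t at least 1. *)
definition eps :: "nat \<Rightarrow> nat \<Rightarrow> nat \<Rightarrow> nat \<Rightarrow> int" where
  "eps d k t x = (int k + 1) * u_sum d k t x - (int d + int t * (int k + 1) - int x)"

end

theory Submission
  imports Defs
begin

text \<open>By the handshake lemma the terms linear in the degrees cancel, so that the numerator equals
  \<open>2h \<Sum>\<^sub>v u\<^sub>t(deg v) = 2h \<Sum>\<^sub>i (t - i) |B\<^sub>i|\<close>, where \<open>B\<^sub>i\<close> is the set of vertices with degree in \<open>I\<^sub>i\<close>.
  Every \<open>B\<^sub>i\<close> has spread at most \<open>k\<close>, hence at most \<open>sp(G,k)\<close> elements, and
  \<open>\<Sum>\<^sub>i (t - i) = t(t + 1)/2\<close>.\<close>

context finite_simple_graph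
begin

lemma finite_edges: "finite E"
  using edge_subset finite_vertices by (meson PowI finite_Pow_iff finite_subset subsetI)

lemma sum_degree: "(\<Sum>v\<in>V. degree E v) = 2 * card E"
  unfolding degree_def
\<comment> \<open>Double counting of incident vertex-edge pairs: each edge contributes its two
  endpoints.\<close>
proof (rule sum_multicount[OF finite_vertices finite_edges], intro ballI)
  fix e assume e: "e \<in> E"
  then have "{v \<in> V. v \<in> e} = e"
    using edge_subset by blast
  with e show "card {v \<in> V. v \<in> e} = 2"
    by (simp add: edge_card)
qed

lemma card_le_sp:
  assumes "B \<subseteq> V" and "\<And>v. v \<in> B \<Longrightarrow> degree E v \<in> {a..a + k}"
  shows "card B \<le> sp V E k"
\<comment> \<open>The maximum in \<open>sp\<close> ranges over nonempty sets only, so the empty set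
  is treated apart.\<close>
proof (cases "B = {}")
  case False
  have "finite B"
    using assms(1) finite_vertices finite_subset by blast
  with False have "Max (degree E ` B) \<le> a + k" "a \<le> Min (degree E ` B)"
    using assms(2) by auto
  then have "spread E B \<le> int k"
    by (simp add: spread_def)
  moreover have "finite {card B | B. B \<subseteq> V \<and> B \<noteq> {} \<and> spread E B \<le> int k}"
    by (rule finite_subset[of _ "card ` Pow V"]) (use finite_vertices in auto)
  ultimately show ?thesis
    unfolding sp_def using assms(1) False by (intro Max_ge) auto
qed simp

text \<open>The sum counts the vertices with degree in the \<open>i\<close>-th interval, a window of
  \<open>k + 1\<close> consecutive values, so \<open>card_le_sp\<close> applies with
  \<open>a\<close> its left end.\<close>

lemma sum_mu_le_sp: "(\<Sum>v\<in>V. mu d k (degree E v) i) \<le> int (sp V E k)"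
proof -
  have "(\<Sum>v\<in>V. mu d k (degree E v) i) = int (card {v \<in> V. degree E v \<in> deg_interval d k i})"
    by (simp add: mu_def finite_vertices flip: sum.inter_filter)
  also have "\<dots> \<le> int (sp V E k)"
    by (simp only: of_nat_le_iff, rule card_le_sp[where a = "d + i * (k + 1)"])
      (auto simp: deg_interval_def)
  finally show ?thesis .
qed

lemma sum_eps:
  "(\<Sum>v\<in>V. eps d k t (degree E v)) =
    (int k + 1) * (\<Sum>v\<in>V. u_sum d k t (degree E v))
      - int (card V) * (int d + int t * (int k + 1)) + 2 * int (card E)"
proof -
  have "(\<Sum>v\<in>V. int (degree E v)) = 2 * int (card E)"
    using arg_cong[OF sum_degree, of int] by simp
  then show ?thesis
    by (simp add: eps_def sum_subtractf sum.distrib sum_distrib_left)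
qed

end

text \<open>The factor 2 keeps the triangular number free of integer division.\<close>

lemma double_sum_descending: "2 * (\<Sum>i = 0..<t. int t - int i) = int t * (int t + 1)"
proof -
  have "2 * (\<Sum>i = 0..<t. int i) = int t * (int t - 1)"
    by (induction t) (auto simp: algebra_simps)
  then show ?thesis
    by (simp add: sum_subtractf algebra_simps)
qed

lemma (in finite_simple_graph) double_sum_u_sum_le:
  "2 * (\<Sum>v\<in>V. u_sum d k t (degree E v)) \<le> int t * (int t + 1) * int (sp V E k)"
proof -
  have "(\<Sum>v\<in>V. u_sum d k t (degree E v)) =
      (\<Sum>i = 0..<t. (int t - int i) * (\<Sum>v\<in>V. mu d k (degree E v) i))"
    \<comment> \<open>Summing over the vertices first isolates one degree interval for each
      \<open>i\<close>.\<close>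
    unfolding u_sum_def sum_distrib_left by (rule sum.swap)
  also have "\<dots> \<le> (\<Sum>i = 0..<t. (int t - int i) * int (sp V E k))"
    \<comment> \<open>The weights \<open>int t - int i\<close> are nonnegative because
      \<open>i < t\<close>.\<close>
    by (intro sum_mono mult_left_mono sum_mu_le_sp) auto
  also have "\<dots> = (\<Sum>i = 0..<t. int t - int i) * int (sp V E k)"
    by (simp add: sum_distrib_right)
  finally show ?thesis
    unfolding double_sum_descending[symmetric] by simp
qed

theorem theorem2:
  fixes V :: "'a set" and E :: "'a set set" and k t :: nat
  assumes "finite_simple_graph V E"
    and "V \<noteq> {}"
    and "t \<ge> 1"
  shows "real (sp V E k) \<ge>
    2 * (real (card V) * (real (min_degree V E) + real t * (real k + 1)) - 2 * real (card E)
         + (\<Sum>v\<in>V. real_of_int (eps (min_degree V E) k t (degree E v))))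
    / ((real k + 1) * real t * (real t + 1))"
proof -
  interpret finite_simple_graph V E
    by (rule assms(1))
  define d where "d = min_degree V E"
  define U where "U = (\<Sum>v\<in>V. u_sum d k t (degree E v))"
  have "(\<Sum>v\<in>V. real_of_int (eps d k t (degree E v))) =
      (real k + 1) * real_of_int U
        - real (card V) * (real d + real t * (real k + 1)) + 2 * real (card E)"
    using arg_cong[OF sum_eps[of d k t], of real_of_int] by (simp add: U_def)
  then have num: "2 * (real (card V) * (real d + real t * (real k + 1)) - 2 * real (card E)
         + (\<Sum>v\<in>V. real_of_int (eps d k t (degree E v)))) = (real k + 1) * (2 * real_of_int U)"
    by (simp add: algebra_simps)
  have "real_of_int (2 * U) \<le> real_of_int (int t * (int t + 1) * int (sp V E k))"
    unfolding of_int_le_iff U_def by (rule double_sum_u_sum_le)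
  then have "(real k + 1) * (2 * real_of_int U)
      \<le> (real k + 1) * (real t * (real t + 1) * real (sp V E k))"
    by (intro mult_left_mono) auto
  \<comment> \<open>Here \<open>t \<ge> 1\<close> makes the denominator positive, so that it can be
    cleared.\<close>
  moreover have "(real k + 1) * real t * (real t + 1) > 0"
    using assms(3) by simp
  ultimately show ?thesis
    unfolding d_def[symmetric] num by (simp add: pos_divide_le_eq mult_ac)
qed

end
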